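(* The space $\mathbb{G}^{\mathbb{N}}$, the countable power of the Gurariĭ space $\mathbb{G}$ with the product topology, is universal for separable Fréchet spaces: every separable Fréchet space is linearly homeomorphic to a linear subspace of $\mathbb{G}^{\mathbb{N}}$.
   Context: A Fréchet space is a complete metrizable locally convex space. The Gurariĭ space $\mathbb{G}$ is the separable Banach space, unique up to linear isometry, such that for every $\varepsilon>0$, all finite-dimensional normed spaces $E\subseteq F$ and every isometric embedding $e\colon E\to\mathbb{G}$ there is a linear map $f\colon F\to\mathbb{G}$ with $f\restriction E=e$ and $(1+\varepsilon)^{-1}\|x\|\le\|f(x)\|\le(1+\varepsilon)\|x\|$ for all $x\in F$. *)

theory Defs
  imports "HOL-Analysis.Analysis" "HOL-Library.Function_Algebras"
begin

text \<open>Pointwise vector space structure on functions. Together with the product topology that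
  \<^theory>\<open>HOL-Analysis.Function_Topology\<close> puts on function types, this makes \<^typ>\<open>nat \<Rightarrow> 'g\<close> the
  countable power of a topological vector space \<^typ>\<open>'g\<close>.\<close>

instantiation "fun" :: (type, real_vector) real_vector
begin

definition scaleR_fun :: "real \<Rightarrow> ('a \<Rightarrow> 'b) \<Rightarrow> 'a \<Rightarrow> 'b"
  where "scaleR_fun c f = (\<lambda>i. c *\<^sub>R f i)"

instance
  by standard (auto simp: scaleR_fun_def plus_fun_def scaleR_add_right scaleR_add_left)

end

class real_topological_vector_space =
  real_vector + topological_ab_group_add + uniform_topological_group_add +
  assumes tendsto_scaleR_Pair:
    "LIM p (nhds c \<times>\<^sub>F nhds x). fst p *\<^sub>R snd p :> nhds (c *\<^sub>R x)"

text \<open>The uniformity of a \<^class>\<open>uniform_topological_group_add\<close> is necessarily the canonical one,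
  generated by the entourages \<open>{(x, y). y - x \<in> U}\<close> for neighbourhoods \<open>U\<close> of \<open>0\<close>
  (library fact \<open>cauchy_seq_finset_iff_vanishing\<close>). Hence \<^term>\<open>complete UNIV\<close> below is completeness in
  the sense of topological vector spaces.\<close>

definition frechet_space :: "'f::real_topological_vector_space itself \<Rightarrow> bool"
  where "frechet_space _ \<longleftrightarrow>
    complete (UNIV :: 'f set) \<and>
    metrizable_space (euclidean :: 'f topology) \<and>
    (\<forall>U :: 'f set. open U \<and> 0 \<in> U \<longrightarrow> (\<exists>V. open V \<and> convex V \<and> 0 \<in> V \<and> V \<subseteq> U))"

definition linear_on :: "'a::real_vector set \<Rightarrow> ('a \<Rightarrow> 'b::real_vector) \<Rightarrow> bool"
  where "linear_on V f \<longleftrightarrow>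
    (\<forall>x\<in>V. \<forall>y\<in>V. f (x + y) = f x + f y) \<and> (\<forall>c. \<forall>x\<in>V. f (c *\<^sub>R x) = c *\<^sub>R f x)"

definition norm_on :: "'a::real_vector set \<Rightarrow> ('a \<Rightarrow> real) \<Rightarrow> bool"
  where "norm_on V N \<longleftrightarrow>
    (\<forall>x\<in>V. 0 \<le> N x) \<and>
    (\<forall>x\<in>V. N x = 0 \<longleftrightarrow> x = 0) \<and>
    (\<forall>c. \<forall>x\<in>V. N (c *\<^sub>R x) = \<bar>c\<bar> * N x) \<and>
    (\<forall>x\<in>V. \<forall>y\<in>V. N (x + y) \<le> N x + N y)"

text \<open>HOL cannot quantify over types inside a formula, so the finite-dimensional normed spaces
  \<open>E \<subseteq> F\<close> are taken to be finite-dimensional linear subspaces of \<^typ>\<open>nat \<Rightarrow> real\<close>, with an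
  arbitrary norm \<open>N\<close> on \<open>F\<close>. This loses no generality: \<^typ>\<open>nat \<Rightarrow> real\<close> contains linear subspaces
  of every finite dimension, so every finite-dimensional real normed space is linearly isometric
  to such a pair \<open>(F, N)\<close>. The topology of \<^typ>\<open>nat \<Rightarrow> real\<close> plays no role here.\<close>

definition gurarij_space :: "'g::banach itself \<Rightarrow> bool"
  where "gurarij_space _ \<longleftrightarrow>
    separable_space (euclidean :: 'g topology) \<and>
    (\<forall>\<epsilon>>0. \<forall>(E :: (nat \<Rightarrow> real) set) F N. \<forall>e :: (nat \<Rightarrow> real) \<Rightarrow> 'g.
       subspace E \<and> subspace F \<and> E \<subseteq> F \<and> (\<exists>B. finite B \<and> span B = F) \<and> norm_on F N \<and>
       linear_on E e \<and> (\<forall>x\<in>E. norm (e x) = N x) \<longrightarrow>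
       (\<exists>f :: (nat \<Rightarrow> real) \<Rightarrow> 'g.
          linear_on F f \<and> (\<forall>x\<in>E. f x = e x) \<and>
          (\<forall>x\<in>F. inverse (1 + \<epsilon>) * N x \<le> norm (f x) \<and> norm (f x) \<le> (1 + \<epsilon>) * N x)))"

end

theory Submission
  imports Defs
begin

text \<open>The topology of a separable Frechet space is generated by countably many continuous seminorms
  \<open>p\<^sub>n\<close>, the gauges of a countable base of convex symmetric neighbourhoods of \<open>0\<close>. It suffices to
  find, for each of them, a linear map \<open>T\<^sub>n\<close> into the Gurarij space with
  \<open>p\<^sub>n x / 2 \<le> \<parallel>T\<^sub>n x\<parallel> \<le> 2 p\<^sub>n x\<close>: the map \<open>x \<mapsto> (T\<^sub>n x)\<^sub>n\<close> is then continuous because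
  each \<open>p\<^sub>n\<close> is, and injective with continuous inverse because a small \<open>T\<^sub>n x\<close> forces \<open>x\<close> into the
  \<open>n\<close>-th basic neighbourhood (\<open>embedding_of_seminorm_family\<close>).

  Consider first a norm \<open>N\<close> on the span of a sequence. The map is built along the finite-dimensional
  spans of the initial segments. The Gurarij property extends only maps that are exactly isometric, whereas
  its output is only nearly isometric. This is repaired by renorming: if \<open>e\<close> has distortion at most
  \<open>c\<close> on \<open>E\<close>, then \<open>x \<mapsto> \<parallel>e x\<parallel>\<close> is a norm on \<open>E\<close> within a factor \<open>c\<close> of \<open>N\<close>, and it extends to a
  norm on the next space \<open>F\<close> that is still within the factor \<open>c\<close> of \<open>N\<close> (\<open>norm_on_extension\<close>). For
  this new norm \<open>e\<close> is an isometry, so it extends to \<open>F\<close> with distortion as little above \<open>c\<close> as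
  desired (\<open>gurarij_extension\<close>). Keeping all the distortions below \<open>2\<close>, the union of the maps obtained
  is the required one.

  A continuous seminorm \<open>p\<close> on a separable space reduces to this case: a linear projection discards
  the kernel of \<open>p\<close>, a countable independent set is coded by sequences of reals, and the map obtained
  on a dense subspace extends by completeness of the Gurarij space.\<close>

section \<open>Extending norms with control\<close>

lemma linear_on_diff:
  assumes "subspace V" "linear_on V f" "x \<in> V" "y \<in> V"
  shows "f (x - y) = f x - f y"
proof -
  have "f (x - y) = f (x + (-1) *\<^sub>R y)" by simp
  also have "\<dots> = f x + f ((-1) *\<^sub>R y)"
    using assms unfolding linear_on_def by (blast intro: subspace_scale)
  also have "f ((-1) *\<^sub>R y) = (-1) *\<^sub>R f y"
    using assms unfolding linear_on_def by blast
  finally show ?thesis by simp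
qed

text \<open>The open unit ball of the extension is the convex hull of the open unit ball of \<open>M\<close> and of the
  open ball of \<open>N\<close> of radius \<open>1 / b\<close>. As a formula this is an infimal convolution,
  \<open>N' x = inf {M e + b N (x - e) | e \<in> E}\<close>. It restricts to \<open>M\<close> because \<open>M \<le> b N\<close> on \<open>E\<close>, and it
  stays above \<open>a N\<close> because both \<open>M\<close> and \<open>b N\<close> do.\<close>

lemma norm_on_extension:
  fixes N M :: "'a::real_vector \<Rightarrow> real"
  assumes E: "subspace E" and F: "subspace F" and EF: "E \<subseteq> F"
    and N: "norm_on F N" and M: "norm_on E M"
    and ab: "0 < a" "a \<le> b"
    and MN: "\<And>x. x \<in> E \<Longrightarrow> a * N x \<le> M x" "\<And>x. x \<in> E \<Longrightarrow> M x \<le> b * N x"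
  obtains N' where "norm_on F N'" "\<And>x. x \<in> E \<Longrightarrow> N' x = M x"
    "\<And>x. x \<in> F \<Longrightarrow> a * N x \<le> N' x" "\<And>x. x \<in> F \<Longrightarrow> N' x \<le> b * N x"
proof -
  define h where "h x e = M e + b * N (x - e)" for x e
  define N' where "N' x = (INF e\<in>E. h x e)" for x
  have N0: "0 \<le> N x" if "x \<in> F" for x using N that by (auto simp: norm_on_def)
  have Nz: "N x = 0 \<longleftrightarrow> x = 0" if "x \<in> F" for x using N that by (auto simp: norm_on_def)
  have Ns: "N (c *\<^sub>R x) = \<bar>c\<bar> * N x" if "x \<in> F" for x c using N that by (auto simp: norm_on_def)
  have Na: "N (x + y) \<le> N x + N y" if "x \<in> F" "y \<in> F" for x y
    using N that by (auto simp: norm_on_def)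
  have Ms: "M (c *\<^sub>R x) = \<bar>c\<bar> * M x" if "x \<in> E" for x c using M that by (auto simp: norm_on_def)
  have Ma: "M (x + y) \<le> M x + M y" if "x \<in> E" "y \<in> E" for x y
    using M that by (auto simp: norm_on_def)
  have zE: "0 \<in> E" using E by (rule subspace_0)
  have M0: "M 0 = 0" using M zE by (auto simp: norm_on_def)
  have inF: "x - e \<in> F" if "x \<in> F" "e \<in> E" for x e
    using that EF F by (auto intro: subspace_diff)
  have lower: "a * N x \<le> h x e" if x: "x \<in> F" and e: "e \<in> E" for x e
  proof -
    have "N x \<le> N e + N (x - e)" using Na[of e "x - e"] inF[OF x e] e EF by auto
    then have "a * N x \<le> a * N e + a * N (x - e)"
      using ab by (metis distrib_left less_imp_le mult_left_mono)
    also have "\<dots> \<le> M e + b * N (x - e)"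
      using MN(1)[OF e] mult_right_mono[OF ab(2) N0[OF inF[OF x e]]] by linarith
    finally show ?thesis by (simp add: h_def)
  qed
  have bdd: "bdd_below (h x ` E)" if "x \<in> F" for x
    using lower[OF that] by (auto intro!: bdd_belowI[of _ "a * N x"])
  have N'_le: "N' x \<le> h x e" if "x \<in> F" "e \<in> E" for x e
    unfolding N'_def by (rule cINF_lower[OF bdd]) (use that in auto)
  have N'_ge: "r \<le> N' x" if "\<And>e. e \<in> E \<Longrightarrow> r \<le> h x e" for x r
    unfolding N'_def by (rule cINF_greatest) (use that zE in auto)
  have low: "a * N x \<le> N' x" if "x \<in> F" for x
    using N'_ge lower that by blast
  have upp: "N' x \<le> b * N x" if "x \<in> F" for x
    using N'_le[OF that zE] by (simp add: h_def M0)
  have ext: "N' x = M x" if x: "x \<in> E" for x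
  proof (rule antisym)
    show "N' x \<le> M x" using N'_le[of x x] x EF Nz[of 0] zE by (force simp: h_def)
    show "M x \<le> N' x"
    proof (rule N'_ge)
      fix e assume e: "e \<in> E"
      have d: "x - e \<in> E" using x e E by (auto intro: subspace_diff)
      have "M x \<le> M e + M (x - e)" using Ma[OF e d] by simp
      then show "M x \<le> h x e" using MN(2)[OF d] by (simp add: h_def)
    qed
  qed
  have scale_le: "N' (c *\<^sub>R x) \<le> \<bar>c\<bar> * N' x" if x: "x \<in> F" and c: "c \<noteq> 0" for c x
  proof -
    have "N' (c *\<^sub>R x) / \<bar>c\<bar> \<le> N' x"
    proof (rule N'_ge)
      fix e assume e: "e \<in> E"
      have "N' (c *\<^sub>R x) \<le> h (c *\<^sub>R x) (c *\<^sub>R e)"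
        using N'_le e E x F by (auto intro: subspace_scale)
      also have "\<dots> = \<bar>c\<bar> * h x e"
        using Ms[OF e, of c] Ns[OF inF[OF x e], of c]
        by (simp add: h_def algebra_simps)
      finally show "N' (c *\<^sub>R x) / \<bar>c\<bar> \<le> h x e" using c by (simp add: field_simps)
    qed
    then show ?thesis using c by (simp add: field_simps)
  qed
  have scale: "N' (c *\<^sub>R x) = \<bar>c\<bar> * N' x" if x: "x \<in> F" for c x
  proof (cases "c = 0")
    case True
    then show ?thesis using ext[OF zE] M0 by simp
  next
    case False
    have "N' (inverse c *\<^sub>R c *\<^sub>R x) \<le> \<bar>inverse c\<bar> * N' (c *\<^sub>R x)"
      using x F False by (intro scale_le) (auto intro: subspace_scale)
    then have "\<bar>c\<bar> * N' x \<le> N' (c *\<^sub>R x)" using False by (simp add: field_simps)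
    with scale_le[OF x False] show ?thesis by simp
  qed
  have tri: "N' (x + y) \<le> N' x + N' y" if x: "x \<in> F" and y: "y \<in> F" for x y
  proof -
    have *: "N' (x + y) \<le> h x e + h y e'" if e: "e \<in> E" and e': "e' \<in> E" for e e'
    proof -
      have "N' (x + y) \<le> h (x + y) (e + e')"
        using N'_le e e' E x y F by (auto intro: subspace_add)
      also have "\<dots> \<le> h x e + h y e'"
      proof -
        have "N (x + y - (e + e')) \<le> N (x - e) + N (y - e')"
          using Na[OF inF[OF x e] inF[OF y e']] by (simp add: algebra_simps)
        then have "b * N (x + y - (e + e')) \<le> b * N (x - e) + b * N (y - e')"
          using ab by (metis distrib_left less_imp_le mult_left_mono order_less_le_trans)
        with Ma[OF e e'] show ?thesis by (simp add: h_def)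
      qed
      finally show ?thesis .
    qed
    have "N' (x + y) - h y e' \<le> N' x" if "e' \<in> E" for e'
      by (rule N'_ge) (use *[OF _ that] in \<open>simp add: diff_le_eq\<close>)
    then have "N' (x + y) - N' x \<le> N' y"
      by (intro N'_ge) (smt (verit))
    then show ?thesis by simp
  qed
  have "norm_on F N'"
    unfolding norm_on_def
  proof (intro conjI ballI allI)
    fix x assume x: "x \<in> F"
    have "0 \<le> a * N x" using N0[OF x] ab by simp
    then show "0 \<le> N' x" using low[OF x] by linarith
    show "N' x = 0 \<longleftrightarrow> x = 0"
    proof
      assume "N' x = 0"
      then have "N x \<le> 0" using low[OF x] ab by (simp add: mult_le_0_iff)
      then show "x = 0" using N0[OF x] Nz[OF x] by simp
    qed (use ext[OF zE] M0 in simp)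
  qed (use scale tri in auto)
  then show ?thesis using that ext low upp by blast
qed

section \<open>Embedding countably spanned normed spaces\<close>

text \<open>The norm \<open>x \<mapsto> \<parallel>e x\<parallel>\<close> of \<open>E\<close> is extended to \<open>F\<close> within the same bounds, so that the Gurarij
  property applies to \<open>e\<close> as an isometry; the loss from \<open>c\<close> to \<open>d\<close> is that of the property itself.\<close>

lemma gurarij_extension:
  fixes e :: "(nat \<Rightarrow> real) \<Rightarrow> 'g::banach"
  assumes G: "gurarij_space TYPE('g)"
    and E: "subspace E" and F: "subspace F" and EF: "E \<subseteq> F" and fin: "\<exists>B. finite B \<and> span B = F"
    and N: "norm_on F N" and e: "linear_on E e" and cd: "1 \<le> c" "c < d"
    and bounds: "\<And>x. x \<in> E \<Longrightarrow> N x / c \<le> norm (e x) \<and> norm (e x) \<le> c * N x"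
  obtains f :: "(nat \<Rightarrow> real) \<Rightarrow> 'g" where "linear_on F f" "\<And>x. x \<in> E \<Longrightarrow> f x = e x"
    "\<And>x. x \<in> F \<Longrightarrow> N x / d \<le> norm (f x) \<and> norm (f x) \<le> d * N x"
proof -
  have N0: "0 \<le> N x" if "x \<in> F" for x using N that by (auto simp: norm_on_def)
  have e0: "e 0 = 0"
    using linear_on_diff[OF E e subspace_0[OF E] subspace_0[OF E]] by simp
  have M: "norm_on E (\<lambda>x. norm (e x))"
    unfolding norm_on_def
  proof (intro conjI ballI allI)
    fix x assume x: "x \<in> E"
    show "norm (e x) = 0 \<longleftrightarrow> x = 0"
    proof
      assume "norm (e x) = 0"
      then have "N x \<le> 0" using bounds[OF x] cd by (simp add: field_simps)
      then have "N x = 0" using N0[of x] x EF by force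
      then show "x = 0" using N x EF by (auto simp: norm_on_def)
    qed (simp add: e0)
    show "norm (e (r *\<^sub>R x)) = \<bar>r\<bar> * norm (e x)" for r
      using e x by (simp add: linear_on_def)
    show "norm (e (x + y)) \<le> norm (e x) + norm (e y)" if "y \<in> E" for y
      using e x that by (simp add: linear_on_def norm_triangle_ineq)
  qed simp
  have "1 / c \<le> 1" "1 / c > 0" using cd by (auto simp: field_simps)
  then have "0 < 1 / c" "1 / c \<le> c" using cd by linarith+
  then obtain N' where N': "norm_on F N'" "\<And>x. x \<in> E \<Longrightarrow> N' x = norm (e x)"
    "\<And>x. x \<in> F \<Longrightarrow> 1 / c * N x \<le> N' x" "\<And>x. x \<in> F \<Longrightarrow> N' x \<le> c * N x"
    using norm_on_extension[OF E F EF N M, of "1 / c" c] bounds by auto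
  define k where "k = d / c"
  have k: "1 < k" "d = k * c" using cd by (auto simp: k_def field_simps)
  have "k - 1 > 0" using k by simp
  then obtain f :: "(nat \<Rightarrow> real) \<Rightarrow> 'g" where f: "linear_on F f" "\<And>x. x \<in> E \<Longrightarrow> f x = e x"
    "\<And>x. x \<in> F \<Longrightarrow> inverse (1 + (k - 1)) * N' x \<le> norm (f x) \<and> norm (f x) \<le> (1 + (k - 1)) * N' x"
    using G[unfolded gurarij_space_def, THEN conjunct2, rule_format, of "k - 1" E F N' e]
      E F EF fin N'(1,2) e by auto
  show ?thesis
  proof
    fix x assume x: "x \<in> F"
    have "N x / d = inverse k * (1 / c * N x)" using k by (simp add: field_simps)
    also have "\<dots> \<le> inverse k * N' x"
      using N'(3)[OF x] k by (intro mult_left_mono) auto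
    finally have 1: "N x / d \<le> inverse k * N' x" .
    have "k * N' x \<le> k * (c * N x)"
      using N'(4)[OF x] k by (intro mult_left_mono) auto
    then have 2: "k * N' x \<le> d * N x" using k by (simp add: mult.assoc)
    show "N x / d \<le> norm (f x) \<and> norm (f x) \<le> d * N x"
      using f(3)[OF x] 1 2 by auto
  qed (use f in auto)
qed

text \<open>On the span of the first \<open>n\<close> vectors the distortion is allowed to be \<open>2 - 1 / 2 ^ n\<close>. These
  bounds increase strictly, which leaves the room that each step of \<open>gurarij_extension\<close> needs, and
  never reach \<open>2\<close>. Since each step extends the previous map exactly, the maps have a union.\<close>

lemma gurarij_embeds_countably_spanned:
  fixes N :: "(nat \<Rightarrow> real) \<Rightarrow> real"
  assumes G: "gurarij_space TYPE('g::banach)" and C: "countable C" and N: "norm_on (span C) N"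
  obtains f :: "(nat \<Rightarrow> real) \<Rightarrow> 'g::banach" where "linear_on (span C) f"
    "\<And>x. x \<in> span C \<Longrightarrow> N x / 2 \<le> norm (f x) \<and> norm (f x) \<le> 2 * N x"
proof (cases "C = {}")
  case True
  have "linear_on (span C) (\<lambda>_. 0 :: 'g)" by (simp add: linear_on_def)
  moreover have "N 0 = 0" using N span_zero[of C] unfolding norm_on_def by blast
  ultimately show ?thesis using that True by simp
next
  case False
  then obtain v :: "nat \<Rightarrow> nat \<Rightarrow> real" where v: "C = range v"
    using C by (metis range_from_nat_into)
  define E where "E n = span (v ` {..<n})" for n
  define c :: "nat \<Rightarrow> real" where "c n = 2 - 1 / 2 ^ n" for n
  have c: "1 \<le> c n" "c n < c (Suc n)" "c n \<le> 2" for n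
    by (auto simp: c_def field_simps)
  have subE: "subspace (E n)" for n by (simp add: E_def)
  have EC: "E n \<subseteq> span C" for n unfolding E_def v by (intro span_mono) auto
  have mono: "E m \<subseteq> E n" if "m \<le> n" for m n
    unfolding E_def using that by (intro span_mono) auto
  have NE: "norm_on (E n) N" for n
    using N EC[of n] unfolding norm_on_def by (meson subsetD)
  define good :: "nat \<Rightarrow> ((nat \<Rightarrow> real) \<Rightarrow> 'g) \<Rightarrow> bool" where
    "good n f \<longleftrightarrow> linear_on (E n) f \<and>
       (\<forall>x\<in>E n. N x / c n \<le> norm (f x) \<and> norm (f x) \<le> c n * N x)" for n f
  have "\<exists>f. \<forall>n. good n (f n) \<and> (\<forall>x\<in>E n. f (Suc n) x = f n x)"
  proof (rule dependent_nat_choice)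
    have "good 0 (\<lambda>_. 0)"
      using NE[of 0] by (simp add: good_def E_def linear_on_def norm_on_def)
    then show "\<exists>f. good 0 f" by blast
  next
    fix f n assume f: "good n f"
    show "\<exists>g. good (Suc n) g \<and> (\<forall>x\<in>E n. g x = f x)"
    proof -
      have fin: "\<exists>B. finite B \<and> span B = E (Suc n)"
        unfolding E_def by (intro exI[of _ "v ` {..<Suc n}"]) simp
      have lin: "linear_on (E n) f"
        and bounds: "\<And>x. x \<in> E n \<Longrightarrow> N x / c n \<le> norm (f x) \<and> norm (f x) \<le> c n * N x"
        using f by (auto simp: good_def)
      obtain g :: "(nat \<Rightarrow> real) \<Rightarrow> 'g" where "linear_on (E (Suc n)) g"
        "\<And>x. x \<in> E n \<Longrightarrow> g x = f x"
        "\<And>x. x \<in> E (Suc n) \<Longrightarrow> N x / c (Suc n) \<le> norm (g x) \<and> norm (g x) \<le> c (Suc n) * N x"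
        using gurarij_extension[OF G subE subE mono fin NE lin c(1,2) bounds] by auto
      then show ?thesis by (auto simp: good_def)
    qed
  qed
  then obtain f where f: "\<And>n. good n (f n)" "\<And>n x. x \<in> E n \<Longrightarrow> f (Suc n) x = f n x"
    by blast
  have coh: "f n x = f m x" if "m \<le> n" "x \<in> E m" for m n x
    using that(1)
  proof (induction n rule: dec_induct)
    case (step n)
    then show ?case using f(2) mono that(2) by (metis subsetD)
  qed simp
  have cover: "\<exists>n. x \<in> E n" if "x \<in> span C" for x
    using that
  proof (induction rule: span_induct_alt)
    case base
    show ?case using subspace_0[OF subE] by blast
  next
    case (step r z y)
    then obtain m k where m: "y \<in> E m" and k: "z = v k" using v by auto
    have "z \<in> E (Suc k)" unfolding k E_def by (intro span_base) auto
    then have "z \<in> E (max m (Suc k))" "y \<in> E (max m (Suc k))"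
      using mono m by (meson max.cobounded1 max.cobounded2 subsetD)+
    then show ?case using subE by (meson subspace_add subspace_scale)
  qed
  define g where "g x = f (LEAST n. x \<in> E n) x" for x
  have g: "g x = f n x" if "x \<in> E n" for x n
    unfolding g_def by (metis LeastI Least_le coh that)
  show ?thesis
  proof
    show "linear_on (span C) g"
      unfolding linear_on_def
    proof (intro conjI ballI allI)
      fix x y assume "x \<in> span C" "y \<in> span C"
      then obtain m k where "x \<in> E m" "y \<in> E k" using cover by meson
      then have xy: "x \<in> E (max m k)" "y \<in> E (max m k)"
        using mono by (meson max.cobounded1 max.cobounded2 subsetD)+
      then have "x + y \<in> E (max m k)" using subE by (meson subspace_add)
      then show "g (x + y) = g x + g y"
        using xy f(1)[of "max m k"] by (simp add: g good_def linear_on_def)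
    next
      fix r x assume "x \<in> span C"
      then obtain m where x: "x \<in> E m" using cover by meson
      then have "r *\<^sub>R x \<in> E m" using subE by (meson subspace_scale)
      then show "g (r *\<^sub>R x) = r *\<^sub>R g x"
        using x f(1)[of m] by (simp add: g good_def linear_on_def)
    qed
  next
    fix x assume x: "x \<in> span C"
    then obtain n where n: "x \<in> E n" using cover by meson
    have N0: "0 \<le> N x" using N x by (auto simp: norm_on_def)
    have "N x / 2 \<le> N x / c n"
      using c(1,3)[of n] N0 by (intro divide_left_mono) auto
    moreover have "c n * N x \<le> 2 * N x"
      using c(3)[of n] N0 by (intro mult_right_mono) auto
    moreover have "N x / c n \<le> norm (g x)" "norm (g x) \<le> c n * N x"
      using f(1)[of n] n by (auto simp: g[OF n] good_def)
    ultimately show "N x / 2 \<le> norm (g x) \<and> norm (g x) \<le> 2 * N x" by linarith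
  qed
qed

section \<open>Separable seminorms\<close>

definition seminorm :: "('a::real_vector \<Rightarrow> real) \<Rightarrow> bool" where
  "seminorm p \<longleftrightarrow> (\<forall>c x. p (c *\<^sub>R x) = \<bar>c\<bar> * p x) \<and> (\<forall>x y. p (x + y) \<le> p x + p y)"

lemma seminorm_scale: "seminorm p \<Longrightarrow> p (c *\<^sub>R x) = \<bar>c\<bar> * p x"
  and seminorm_add: "seminorm p \<Longrightarrow> p (x + y) \<le> p x + p y"
  by (auto simp: seminorm_def)

lemma seminorm_0: "seminorm p \<Longrightarrow> p 0 = 0"
  using seminorm_scale[of p 0 0] by simp

lemma seminorm_uminus: "seminorm p \<Longrightarrow> p (- x) = p x"
  using seminorm_scale[of p "-1" x] by simp

lemma seminorm_commute: "seminorm p \<Longrightarrow> p (x - y) = p (y - x)"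
  using seminorm_uminus[of p "x - y"] by simp

lemma seminorm_nonneg: "seminorm p \<Longrightarrow> 0 \<le> p x"
  using seminorm_add[of p x "- x"] by (simp add: seminorm_0 seminorm_uminus)

lemma seminorm_triangle: "seminorm p \<Longrightarrow> p (x - z) \<le> p (x - y) + p (y - z)"
  using seminorm_add[of p "x - y" "y - z"] by simp

lemma seminorm_abs_diff: "seminorm p \<Longrightarrow> \<bar>p x - p y\<bar> \<le> p (x - y)"
  using seminorm_add[of p y "x - y"] seminorm_add[of p x "y - x"] seminorm_commute[of p x y] by simp

text \<open>A linear complement of the kernel of \<open>p\<close> exists by a choice of basis, and \<open>p\<close> is a norm on
  it.\<close>

lemma seminorm_kernel_projection:
  fixes p :: "'a::real_vector \<Rightarrow> real"
  assumes p: "seminorm p"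
  obtains q :: "'a \<Rightarrow> 'a" where "linear q" "\<And>x. p (q x) = p x" "\<And>x. q (q x) = q x"
    "\<And>x. p x = 0 \<Longrightarrow> q x = 0"
proof -
  define K where "K = {x. p x = 0}"
  have K: "subspace K"
    unfolding K_def
  proof (rule subspaceI)
    show "x + y \<in> {x. p x = 0}" if "x \<in> {x. p x = 0}" "y \<in> {x. p x = 0}" for x y
      using seminorm_add[OF p, of x y] seminorm_nonneg[OF p, of "x + y"] that by simp
  qed (auto simp: seminorm_0[OF p] seminorm_scale[OF p])
  obtain B0 where B0: "B0 \<subseteq> K" "independent B0" "K \<subseteq> span B0"
    using maximal_independent_subset[of K] .
  obtain B where B: "B0 \<subseteq> B" "independent B" "UNIV \<subseteq> span B"
    using maximal_independent_subset_extend[of B0 UNIV] B0(2) by auto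
  obtain q where q: "linear q" "\<And>x. x \<in> B \<Longrightarrow> q x = (if x \<in> B0 then 0 else x)"
    using linear_independent_extend[OF B(2), of "\<lambda>x. if x \<in> B0 then 0 else x"] by auto
  have kill: "q x = 0" if "x \<in> K" for x
  proof (rule linear_eq_0_on_span[OF q(1)])
    show "q b = 0" if "b \<in> B0" for b using that q(2) B(1) by auto
    show "x \<in> span B0" using that B0(3) by auto
  qed
  have inK: "x - q x \<in> K" for x
  proof -
    have "x \<in> span B" using B(3) by auto
    then show ?thesis
    proof (induction rule: span_induct_alt)
      case base
      then show ?case using subspace_0[OF K] linear_0[OF q(1)] by simp
    next
      case (step c b y)
      have b: "b - q b \<in> K" using q(2)[OF step(1)] B0(1) subspace_0[OF K] by auto
      have "c *\<^sub>R b + y - q (c *\<^sub>R b + y) = c *\<^sub>R (b - q b) + (y - q y)"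
        by (simp add: linear_add[OF q(1)] linear_scale[OF q(1)] algebra_simps)
      also have "\<dots> \<in> K" using b step(2) by (intro subspace_add subspace_scale K)
      finally show ?case .
    qed
  qed
  show ?thesis
  proof (rule that)
    show "p (q x) = p x" for x
      using seminorm_abs_diff[OF p, of x "q x"] inK[of x] by (simp add: K_def)
    show "q (q x) = q x" for x
      using kill[OF inK[of x]] by (simp add: linear_diff[OF q(1)])
  qed (use q kill in \<open>auto simp: K_def\<close>)
qed

lemma independent_unit_sequences:
  "independent (range (\<lambda>n i :: nat. if i = n then 1 else 0 :: real))"
  unfolding independent_explicit_module
proof (intro allI impI)
  fix t and u :: "(nat \<Rightarrow> real) \<Rightarrow> real" and w
  assume t: "finite t" "t \<subseteq> range (\<lambda>n i. if i = n then 1 else 0 :: real)"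
    and z: "(\<Sum>x\<in>t. u x *\<^sub>R x) = 0" and w: "w \<in> t"
  obtain n where n: "w = (\<lambda>i. if i = n then 1 else 0)" using t w by blast
  have other: "x n = 0" if x: "x \<in> t" "x \<noteq> w" for x
  proof -
    obtain m where "x = (\<lambda>i. if i = m then 1 else 0)" using t x by blast
    with x n show ?thesis by (cases "m = n") auto
  qed
  have eval: "(\<Sum>x\<in>s. u x *\<^sub>R x) n = (\<Sum>x\<in>s. u x * x n)" if "finite s" for s
    using that by induction (auto simp: scaleR_fun_def)
  have "0 = (\<Sum>x\<in>t. u x * x n)" using eval[OF t(1)] z by simp
  also have "\<dots> = u w * w n"
  proof -
    have "(\<Sum>x\<in>t - {w}. u x * x n) = 0" by (rule sum.neutral) (simp add: other)
    then show ?thesis by (simp add: sum.remove[OF t(1) w])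
  qed
  finally show "u w = 0" by (simp add: n)
qed

text \<open>Projecting off the kernel of \<open>p\<close> and coding a basis by unit sequences turns \<open>p\<close> into a norm on
  a countably spanned space of sequences of reals.\<close>

lemma gurarij_seminorm_on_span:
  fixes p :: "'a::real_vector \<Rightarrow> real"
  assumes G: "gurarij_space TYPE('g::banach)" and p: "seminorm p" and D: "countable D"
  obtains g :: "'a \<Rightarrow> 'g::banach" where "linear_on (span D) g"
    "\<And>x. x \<in> span D \<Longrightarrow> p x / 2 \<le> norm (g x) \<and> norm (g x) \<le> 2 * p x"
proof -
  obtain q where q: "linear q" "\<And>x. p (q x) = p x" "\<And>x. q (q x) = q x"
    "\<And>x. p x = 0 \<Longrightarrow> q x = 0"
    using seminorm_kernel_projection[OF p] by blast
  obtain B where B: "B \<subseteq> q ` D" "independent B" "q ` D \<subseteq> span B"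
    using maximal_independent_subset[of "q ` D"] .
  have cB: "countable B" using B(1) D by (meson countable_image countable_subset)
  define unit :: "nat \<Rightarrow> nat \<Rightarrow> real" where "unit n = (\<lambda>i. if i = n then 1 else 0)" for n
  have inj_unit: "inj unit" by (auto simp: inj_def unit_def fun_eq_iff split: if_splits)
  obtain \<phi> where \<phi>: "linear \<phi>" "\<And>b. b \<in> B \<Longrightarrow> \<phi> b = unit (to_nat_on B b)"
    using linear_independent_extend[OF B(2), of "\<lambda>b. unit (to_nat_on B b)"] by blast
  have "inj_on \<phi> B"
    using inj_on_to_nat_on[OF cB] injD[OF inj_unit] \<phi>(2) by (metis inj_on_def)
  moreover have "\<phi> ` B \<subseteq> range (\<lambda>n i. if i = n then 1 else 0)"
    using \<phi>(2) by (auto simp: unit_def)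
  then have "independent (\<phi> ` B)"
    using independent_unit_sequences independent_mono by blast
  ultimately have "inj_on \<phi> (span B)"
    by (intro linear_inj_on_span_independent_image[OF \<phi>(1)])
  then obtain \<psi> where \<psi>: "linear \<psi>" "\<And>v. v \<in> span B \<Longrightarrow> \<psi> (\<phi> v) = v"
    using linear_exists_left_inverse_on[OF \<phi>(1) subspace_span] by blast
  have im: "span (\<phi> ` B) = \<phi> ` span B" by (rule linear_span_image[OF \<phi>(1)])
  have fixq: "q v = v" if "v \<in> span B" for v
  proof -
    have "subspace {v. q v = v}"
      by (rule subspaceI) (auto simp: linear_0[OF q(1)] linear_add[OF q(1)] linear_scale[OF q(1)])
    moreover have "B \<subseteq> {v. q v = v}" using B(1) q(3) by auto
    ultimately show ?thesis using that span_minimal by blast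
  qed
  have "norm_on (span (\<phi> ` B)) (\<lambda>a. p (\<psi> a))"
    unfolding norm_on_def
  proof (intro conjI ballI allI)
    fix a assume a: "a \<in> span (\<phi> ` B)"
    then obtain v where v: "v \<in> span B" "a = \<phi> v" using im by auto
    show "p (\<psi> a) = 0 \<longleftrightarrow> a = 0"
    proof
      assume "p (\<psi> a) = 0"
      then have "v = 0" using v \<psi>(2) q(4)[of v] fixq[of v] by simp
      then show "a = 0" by (simp add: v(2) linear_0[OF \<phi>(1)])
    qed (simp add: linear_0[OF \<psi>(1)] seminorm_0[OF p])
  qed (auto simp: seminorm_nonneg[OF p] seminorm_scale[OF p] seminorm_add[OF p]
      linear_add[OF \<psi>(1)] linear_scale[OF \<psi>(1)])
  from gurarij_embeds_countably_spanned[OF G countable_image[OF cB] this]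
  obtain f :: "(nat \<Rightarrow> real) \<Rightarrow> 'g" where f: "linear_on (span (\<phi> ` B)) f"
    "\<And>a. a \<in> span (\<phi> ` B) \<Longrightarrow> p (\<psi> a) / 2 \<le> norm (f a) \<and> norm (f a) \<le> 2 * p (\<psi> a)"
    by blast
  have qB: "q x \<in> span B" if "x \<in> span D" for x
  proof -
    have "q x \<in> span (q ` D)" using that linear_span_image[OF q(1), of D] by auto
    then show ?thesis using B(3) by (meson span_minimal subsetD subspace_span)
  qed
  have code: "\<phi> (q x) \<in> span (\<phi> ` B)" if "x \<in> span D" for x
    using qB[OF that] im by auto
  show ?thesis
  proof
    show "linear_on (span D) (\<lambda>x. f (\<phi> (q x)))"
      using f(1) code unfolding linear_on_def
      by (auto simp: linear_add[OF q(1)] linear_scale[OF q(1)] linear_add[OF \<phi>(1)]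
          linear_scale[OF \<phi>(1)])
    show "p x / 2 \<le> norm (f (\<phi> (q x))) \<and> norm (f (\<phi> (q x))) \<le> 2 * p x" if "x \<in> span D" for x
      using f(2)[OF code[OF that]] by (simp add: \<psi>(2)[OF qB[OF that]] q(2))
  qed
qed

text \<open>The value at \<open>x\<close> is the limit of the values of \<open>g\<close> along any sequence of \<open>L\<close> that
  \<open>p\<close>-converges to \<open>x\<close>. Independence of the sequence gives linearity.\<close>

lemma seminorm_bounded_extension:
  fixes p :: "'a::real_vector \<Rightarrow> real" and g :: "'a \<Rightarrow> 'g::banach"
  assumes p: "seminorm p" and L: "subspace L" and g: "linear_on L g" and b: "0 \<le> b"
    and bounds: "\<And>x. x \<in> L \<Longrightarrow> a * p x \<le> norm (g x) \<and> norm (g x) \<le> b * p x"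
    and dense: "\<And>x e. 0 < e \<Longrightarrow> \<exists>y\<in>L. p (x - y) < e"
  obtains T :: "'a \<Rightarrow> 'g" where "linear T" "\<And>x. a * p x \<le> norm (T x) \<and> norm (T x) \<le> b * p x"
proof -
  define appr where "appr x u \<longleftrightarrow> range u \<subseteq> L \<and> (\<lambda>n. p (x - u n)) \<longlonglongrightarrow> 0" for x and u :: "nat \<Rightarrow> 'a"
  have ex: "\<exists>u. appr x u" for x
  proof -
    have "\<exists>y\<in>L. p (x - y) < inverse (real (Suc n))" for n by (rule dense) simp
    then obtain u where u: "\<And>n. u n \<in> L" "\<And>n. p (x - u n) < inverse (real (Suc n))" by metis
    have "(\<lambda>n. p (x - u n)) \<longlonglongrightarrow> 0"
    proof (rule tendsto_sandwich[OF _ _ tendsto_const LIMSEQ_inverse_real_of_nat])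
      show "\<forall>\<^sub>F n in sequentially. 0 \<le> p (x - u n)" using seminorm_nonneg[OF p] by simp
      show "\<forall>\<^sub>F n in sequentially. p (x - u n) \<le> inverse (real (Suc n))"
        using u(2) by (intro always_eventually allI less_imp_le)
    qed
    then show ?thesis using u(1) by (auto simp: appr_def)
  qed
  have diff: "norm (g y - g z) \<le> b * (p (x - y) + p (x - z))" if "y \<in> L" "z \<in> L" for x y z
  proof -
    have "norm (g y - g z) = norm (g (y - z))" using linear_on_diff[OF L g that] by simp
    also have "\<dots> \<le> b * p (y - z)" using bounds subspace_diff[OF L that] by blast
    also have "\<dots> \<le> b * (p (x - y) + p (x - z))"
      using seminorm_triangle[OF p, of y z x] seminorm_commute[OF p, of x y] b
      by (intro mult_left_mono) auto
    finally show ?thesis .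
  qed
  have conv: "convergent (\<lambda>n. g (u n))" if u: "appr x u" for x u
  proof -
    have "Cauchy (\<lambda>n. g (u n))"
    proof (rule CauchyI)
      fix e :: real assume e: "0 < e"
      have "(\<lambda>n. b * p (x - u n)) \<longlonglongrightarrow> b * 0"
        using u unfolding appr_def by (intro tendsto_mult tendsto_const) auto
      then have "\<forall>\<^sub>F n in sequentially. b * p (x - u n) < e / 2"
        using order_tendstoD(2)[of _ "b * 0" sequentially "e / 2"] e by simp
      then obtain M where M: "\<And>n. n \<ge> M \<Longrightarrow> b * p (x - u n) < e / 2"
        by (auto simp: eventually_sequentially)
      show "\<exists>M. \<forall>m\<ge>M. \<forall>n\<ge>M. norm (g (u m) - g (u n)) < e"
      proof (intro exI allI impI)
        fix m n assume mn: "M \<le> m" "M \<le> n"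
        have "norm (g (u m) - g (u n)) \<le> b * p (x - u m) + b * p (x - u n)"
          using diff[of "u m" "u n" x] u by (auto simp: appr_def distrib_left)
        also have "\<dots> < e" using M[OF mn(1)] M[OF mn(2)] by linarith
        finally show "norm (g (u m) - g (u n)) < e" .
      qed
    qed
    then show ?thesis by (rule Cauchy_convergent)
  qed
  define T where "T x = lim (\<lambda>n. g ((SOME u. appr x u) n))" for x
  have T: "(\<lambda>n. g (u n)) \<longlonglongrightarrow> T x" if u: "appr x u" for x u
  proof -
    define s where "s = (SOME u. appr x u)"
    have s: "appr x s" unfolding s_def using ex by (rule someI_ex)
    have lim_s: "(\<lambda>n. g (s n)) \<longlonglongrightarrow> T x"
      using conv[OF s] by (simp add: T_def s_def convergent_LIMSEQ_iff)
    have "(\<lambda>n. b * (p (x - u n) + p (x - s n))) \<longlonglongrightarrow> b * (0 + 0)"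
      using u s unfolding appr_def by (intro tendsto_intros) auto
    then have lim: "(\<lambda>n. b * (p (x - u n) + p (x - s n))) \<longlonglongrightarrow> 0" by simp
    have "norm (g (u n) - g (s n)) \<le> b * (p (x - u n) + p (x - s n))" for n
      using u s by (intro diff) (auto simp: appr_def)
    then have "(\<lambda>n. g (u n) - g (s n)) \<longlonglongrightarrow> 0"
      by (intro Lim_null_comparison[OF _ lim] always_eventually) blast
    from tendsto_add[OF this lim_s] show ?thesis by simp
  qed
  have uL: "u n \<in> L" if "appr x u" for x u n using that by (auto simp: appr_def)
  show ?thesis
  proof
    show "linear T"
    proof (rule linearI)
      fix x y
      obtain u w where u: "appr x u" and w: "appr y w" using ex by meson
      have "appr (x + y) (\<lambda>n. u n + w n)"
        unfolding appr_def
      proof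
        show "range (\<lambda>n. u n + w n) \<subseteq> L" using uL[OF u] uL[OF w] subspace_add[OF L] by auto
        have "(\<lambda>n. p (x - u n) + p (y - w n)) \<longlonglongrightarrow> 0 + 0"
          using u w unfolding appr_def by (intro tendsto_add) auto
        then have lim: "(\<lambda>n. p (x - u n) + p (y - w n)) \<longlonglongrightarrow> 0" by simp
        show "(\<lambda>n. p (x + y - (u n + w n))) \<longlonglongrightarrow> 0"
        proof (rule tendsto_sandwich[OF _ _ tendsto_const lim]; rule always_eventually; rule allI)
          fix n
          show "0 \<le> p (x + y - (u n + w n))" by (rule seminorm_nonneg[OF p])
          show "p (x + y - (u n + w n)) \<le> p (x - u n) + p (y - w n)"
            using seminorm_add[OF p, of "x - u n" "y - w n"] by (simp add: algebra_simps)
        qed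
      qed
      from T[OF this] have "(\<lambda>n. g (u n) + g (w n)) \<longlonglongrightarrow> T (x + y)"
        using g uL[OF u] uL[OF w] by (simp add: linear_on_def)
      moreover have "(\<lambda>n. g (u n) + g (w n)) \<longlonglongrightarrow> T x + T y"
        using T u w by (intro tendsto_add) auto
      ultimately show "T (x + y) = T x + T y" by (rule LIMSEQ_unique)
    next
      fix c x
      obtain u where u: "appr x u" using ex by meson
      have "appr (c *\<^sub>R x) (\<lambda>n. c *\<^sub>R u n)"
        unfolding appr_def
      proof
        show "range (\<lambda>n. c *\<^sub>R u n) \<subseteq> L" using uL[OF u] subspace_scale[OF L] by auto
        have "(\<lambda>n. \<bar>c\<bar> * p (x - u n)) \<longlonglongrightarrow> \<bar>c\<bar> * 0"
          using u unfolding appr_def by (intro tendsto_mult tendsto_const) auto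
        then show "(\<lambda>n. p (c *\<^sub>R x - c *\<^sub>R u n)) \<longlonglongrightarrow> 0"
          by (simp flip: scaleR_diff_right add: seminorm_scale[OF p])
      qed
      from T[OF this] have "(\<lambda>n. c *\<^sub>R g (u n)) \<longlonglongrightarrow> T (c *\<^sub>R x)"
        using g uL[OF u] by (simp add: linear_on_def)
      moreover have "(\<lambda>n. c *\<^sub>R g (u n)) \<longlonglongrightarrow> c *\<^sub>R T x"
        using T[OF u] by (intro tendsto_intros)
      ultimately show "T (c *\<^sub>R x) = c *\<^sub>R T x" by (rule LIMSEQ_unique)
    qed
  next
    fix x
    obtain u where u: "appr x u" using ex by meson
    have "(\<lambda>n. p (u n) - p x) \<longlonglongrightarrow> 0"
    proof (rule Lim_null_comparison)
      show "\<forall>\<^sub>F n in sequentially. norm (p (u n) - p x) \<le> p (x - u n)"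
        using seminorm_abs_diff[OF p] seminorm_commute[OF p]
        by (intro always_eventually allI) (metis real_norm_def)
    qed (use u in \<open>simp add: appr_def\<close>)
    then have pu: "(\<lambda>n. p (u n)) \<longlonglongrightarrow> p x" by (simp add: LIM_zero_iff)
    have nT: "(\<lambda>n. norm (g (u n))) \<longlonglongrightarrow> norm (T x)" using T[OF u] by (rule tendsto_norm)
    have "a * p x \<le> norm (T x)"
      by (rule LIMSEQ_le[OF tendsto_mult[OF tendsto_const pu] nT]) (use bounds uL[OF u] in blast)
    moreover have "norm (T x) \<le> b * p x"
      by (rule LIMSEQ_le[OF nT tendsto_mult[OF tendsto_const pu]]) (use bounds uL[OF u] in blast)
    ultimately show "a * p x \<le> norm (T x) \<and> norm (T x) \<le> b * p x" ..
  qed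
qed

lemma gurarij_embeds_separable_seminorm:
  fixes p :: "'a::real_vector \<Rightarrow> real"
  assumes G: "gurarij_space TYPE('g::banach)" and p: "seminorm p" and D: "countable D"
    and dense: "\<And>x e. 0 < e \<Longrightarrow> \<exists>y\<in>D. p (x - y) < e"
  obtains T :: "'a \<Rightarrow> 'g::banach" where "linear T" "\<And>x. p x / 2 \<le> norm (T x) \<and> norm (T x) \<le> 2 * p x"
proof -
  obtain g :: "'a \<Rightarrow> 'g" where g: "linear_on (span D) g"
    "\<And>x. x \<in> span D \<Longrightarrow> p x / 2 \<le> norm (g x) \<and> norm (g x) \<le> 2 * p x"
    using gurarij_seminorm_on_span[OF G p D] by blast
  have "\<exists>y\<in>span D. p (x - y) < e" if "0 < e" for x e
    using dense[OF that] span_base by blast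
  then show ?thesis
    using seminorm_bounded_extension[OF p subspace_span g(1), of 2 "1 / 2"] g(2) that by auto
qed

section \<open>Gauges of convex neighbourhoods\<close>

text \<open>The Minkowski functional of \<open>W\<close>.\<close>

definition gauge_of :: "'a::real_vector set \<Rightarrow> 'a \<Rightarrow> real" where
  "gauge_of W x = Inf {t. 0 < t \<and> inverse t *\<^sub>R x \<in> W}"

context
  fixes W :: "'a::real_vector set"
  assumes conv: "convex W" and zero: "0 \<in> W"
    and absorbing: "\<And>x. \<exists>t>0. inverse t *\<^sub>R x \<in> W"
begin

lemma gauge_of_le: "0 < t \<Longrightarrow> inverse t *\<^sub>R x \<in> W \<Longrightarrow> gauge_of W x \<le> t"
  unfolding gauge_of_def by (rule cInf_lower) (auto intro!: bdd_belowI[of _ 0])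

lemma gauge_of_nonneg: "0 \<le> gauge_of W x"
  unfolding gauge_of_def using absorbing[of x] by (intro cInf_greatest) auto

lemma gauge_of_less:
  assumes "gauge_of W x < s"
  shows "inverse s *\<^sub>R x \<in> W"
proof -
  obtain t where t: "0 < t" "inverse t *\<^sub>R x \<in> W" "t < s"
    using cInf_lessD[OF _ assms[unfolded gauge_of_def]] absorbing[of x] by auto
  have "(t / s) *\<^sub>R (inverse t *\<^sub>R x) + (1 - t / s) *\<^sub>R 0 \<in> W"
    using t by (intro convexD[OF conv] zero) auto
  then show ?thesis using t by (simp add: field_simps)
qed

lemma seminorm_gauge_of:
  assumes sym: "\<And>x. x \<in> W \<Longrightarrow> - x \<in> W"
  shows "seminorm (gauge_of W)"
proof -
  have scale_le: "gauge_of W (c *\<^sub>R x) \<le> \<bar>c\<bar> * gauge_of W x" if c: "c \<noteq> 0" for c x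
  proof -
    have "gauge_of W (c *\<^sub>R x) / \<bar>c\<bar> \<le> gauge_of W x"
    proof (rule dense_ge)
      fix s assume s: "gauge_of W x < s"
      have s0: "0 < s" using gauge_of_nonneg[of x] s by linarith
      have "inverse (\<bar>c\<bar> * s) *\<^sub>R (c *\<^sub>R x) \<in> W"
      proof (cases "0 < c")
        case True
        then show ?thesis using gauge_of_less[OF s] by (simp add: field_simps)
      next
        case False
        then have "inverse (\<bar>c\<bar> * s) *\<^sub>R (c *\<^sub>R x) = - (inverse s *\<^sub>R x)"
          using c by (simp add: field_simps)
        then show ?thesis using sym[OF gauge_of_less[OF s]] by simp
      qed
      then have "gauge_of W (c *\<^sub>R x) \<le> \<bar>c\<bar> * s" using c s0 by (intro gauge_of_le) auto
      then show "gauge_of W (c *\<^sub>R x) / \<bar>c\<bar> \<le> s" using c by (simp add: field_simps)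
    qed
    then show ?thesis using c by (simp add: field_simps)
  qed
  have "gauge_of W 0 = 0"
  proof (rule antisym[OF dense_ge gauge_of_nonneg])
    show "gauge_of W 0 \<le> s" if "0 < s" for s using gauge_of_le[OF that] zero by simp
  qed
  then have scale: "gauge_of W (c *\<^sub>R x) = \<bar>c\<bar> * gauge_of W x" for c x
  proof (cases "c = 0")
    case False
    have "gauge_of W (inverse c *\<^sub>R c *\<^sub>R x) \<le> \<bar>inverse c\<bar> * gauge_of W (c *\<^sub>R x)"
      using scale_le False by (metis inverse_nonzero_iff_nonzero)
    then have "\<bar>c\<bar> * gauge_of W x \<le> gauge_of W (c *\<^sub>R x)" using False by (simp add: field_simps)
    with scale_le[OF False] show ?thesis by (simp add: antisym)
  qed simp
  have "gauge_of W (x + y) \<le> gauge_of W x + gauge_of W y" for x y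
  proof -
    have *: "gauge_of W (x + y) \<le> s + t" if s: "gauge_of W x < s" and t: "gauge_of W y < t" for s t
    proof (rule gauge_of_le)
      have pos: "0 < s" "0 < t" using gauge_of_nonneg[of x] gauge_of_nonneg[of y] s t by linarith+
      then show "0 < s + t" by simp
      have "(s / (s + t)) *\<^sub>R (inverse s *\<^sub>R x) + (t / (s + t)) *\<^sub>R (inverse t *\<^sub>R y) \<in> W"
        using pos by (intro convexD[OF conv] gauge_of_less s t) (auto simp flip: add_divide_distrib)
      moreover have "s / (s + t) * inverse s = inverse (s + t)"
        "t / (s + t) * inverse t = inverse (s + t)"
        using pos by (auto simp: field_simps)
      ultimately show "inverse (s + t) *\<^sub>R (x + y) \<in> W"
        by (simp add: scaleR_add_right)
    qed
    have "gauge_of W (x + y) \<le> gauge_of W x + gauge_of W y + e" if "0 < e" for e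
      using *[of "gauge_of W x + e / 2" "gauge_of W y + e / 2"] that by simp
    then show ?thesis by (rule field_le_epsilon)
  qed
  with scale show ?thesis by (auto simp: seminorm_def)
qed

end

lemma tendsto_scaleR_nhds:
  fixes x :: "'f::real_topological_vector_space"
  shows "((\<lambda>y. c *\<^sub>R y) \<longlongrightarrow> c *\<^sub>R x) (nhds x)" "((\<lambda>t. t *\<^sub>R x) \<longlongrightarrow> c *\<^sub>R x) (nhds c)"
proof -
  have "filterlim (\<lambda>y. (c, y)) (nhds c \<times>\<^sub>F nhds x) (nhds x)"
    by (intro filterlim_Pair tendsto_const filterlim_ident)
  from filterlim_compose[OF tendsto_scaleR_Pair this]
  show "((\<lambda>y. c *\<^sub>R y) \<longlongrightarrow> c *\<^sub>R x) (nhds x)" by simp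
  have "filterlim (\<lambda>t. (t, x)) (nhds c \<times>\<^sub>F nhds x) (nhds c)"
    by (intro filterlim_Pair tendsto_const filterlim_ident)
  from filterlim_compose[OF tendsto_scaleR_Pair this]
  show "((\<lambda>t. t *\<^sub>R x) \<longlongrightarrow> c *\<^sub>R x) (nhds c)" by simp
qed

text \<open>The seminorm is the gauge of \<open>V \<inter> - V\<close>; the intersection makes the gauge even. Continuity
  of scalar multiplication in the scalar makes this set absorbing, and continuity in the vector
  makes the gauge small near \<open>0\<close>.\<close>

lemma convex_neighbourhood_seminorm:
  fixes U :: "'f::real_topological_vector_space set"
  assumes V: "open V" "convex V" "0 \<in> V" "V \<subseteq> U"
  obtains p where "seminorm p" "\<And>e. 0 < e \<Longrightarrow> \<forall>\<^sub>F x in nhds (0::'f). p x < e" "{x. p x < 1} \<subseteq> U"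
proof -
  define W where "W = V \<inter> uminus ` V"
  have memW: "x \<in> W \<longleftrightarrow> x \<in> V \<and> - x \<in> V" for x
    unfolding W_def by (auto simp: image_iff) (metis minus_minus)
  have conv: "convex W" unfolding W_def
    by (intro convex_Int V(2) convex_negations)
  have zero: "0 \<in> W" using V(3) by (simp add: memW)
  have sym: "- x \<in> W" if "x \<in> W" for x using that by (simp add: memW)
  have evW: "\<forall>\<^sub>F x in nhds (0::'f). x \<in> W"
  proof -
    have "\<forall>\<^sub>F x in nhds (0::'f). x \<in> V" using V(1,3) by (rule eventually_nhds_in_open)
    moreover have "\<forall>\<^sub>F x in nhds (0::'f). - x \<in> V"
      using topological_tendstoD[OF tendsto_uminus_nhds[of "0::'f"] V(1)] V(3) by simp
    ultimately show ?thesis by eventually_elim (simp add: memW)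
  qed
  have absorb: "\<exists>t>0. inverse t *\<^sub>R x \<in> W" for x
  proof -
    have "((\<lambda>t. t *\<^sub>R x) \<longlongrightarrow> 0) (nhds 0)" using tendsto_scaleR_nhds(2)[where c = 0 and x = x] by simp
    then have "\<forall>\<^sub>F t in nhds 0. t *\<^sub>R x \<in> W"
      using evW unfolding filterlim_iff by blast
    then obtain d where d: "0 < d" "\<And>t. dist t 0 < d \<Longrightarrow> t *\<^sub>R x \<in> W"
      unfolding eventually_nhds_metric by blast
    then have "inverse (2 / d) *\<^sub>R x \<in> W" by (intro d) auto
    moreover have "0 < 2 / d" using d by simp
    ultimately show ?thesis by blast
  qed
  show ?thesis
  proof
    show "seminorm (gauge_of W)" by (rule seminorm_gauge_of[OF conv zero absorb sym])
    show "{x. gauge_of W x < 1} \<subseteq> U"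
    proof
      fix x assume "x \<in> {x. gauge_of W x < 1}"
      then have "inverse 1 *\<^sub>R x \<in> W" by (intro gauge_of_less[OF conv zero absorb]) simp
      then show "x \<in> U" using V(4) by (auto simp: memW)
    qed
  next
    fix e :: real assume e: "0 < e"
    have "((\<lambda>y. (2 / e) *\<^sub>R y) \<longlongrightarrow> 0) (nhds (0::'f))"
      using tendsto_scaleR_nhds(1)[where c = "2 / e" and x = 0] by simp
    then have "\<forall>\<^sub>F x in nhds (0::'f). (2 / e) *\<^sub>R x \<in> W"
      using evW unfolding filterlim_iff by blast
    then show "\<forall>\<^sub>F x in nhds (0::'f). gauge_of W x < e"
    proof eventually_elim
      case (elim x)
      then have "gauge_of W x \<le> e / 2"
        using e by (intro gauge_of_le[OF conv zero absorb]) auto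
      then show ?case using e by simp
    qed
  qed
qed

section \<open>Embedding into the countable power\<close>

lemma tendsto_minus_point_nhds:
  fixes x :: "'f::topological_group_add"
  shows "((\<lambda>y. y - x) \<longlongrightarrow> 0) (nhds x)"
proof -
  have "((\<lambda>y. y + - x) \<longlongrightarrow> x + - x) (nhds x)"
    by (intro tendsto_add tendsto_const filterlim_ident)
  then show ?thesis by simp
qed

text \<open>Upper bounds on the coordinates give continuity, lower bounds give injectivity and continuity
  of the inverse; by linearity both need to be examined only near \<open>0\<close>.\<close>

lemma embedding_of_seminorm_family:
  fixes p :: "nat \<Rightarrow> 'f::real_topological_vector_space \<Rightarrow> real"
    and t :: "nat \<Rightarrow> 'f \<Rightarrow> 'g::real_normed_vector"
  assumes cont: "\<And>n e. 0 < e \<Longrightarrow> \<forall>\<^sub>F x in nhds (0::'f). p n x < e"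
    and base: "\<And>U. open U \<Longrightarrow> 0 \<in> U \<Longrightarrow> \<exists>n. {x. p n x < 1} \<subseteq> U"
    and sep: "\<And>x. x \<noteq> 0 \<Longrightarrow> \<exists>U. open U \<and> (0::'f) \<in> U \<and> x \<notin> U"
    and lin: "\<And>n. linear (t n)"
    and bounds: "\<And>n x. p n x / 2 \<le> norm (t n x) \<and> norm (t n x) \<le> 2 * p n x"
  shows "\<exists>(S :: (nat \<Rightarrow> 'g) set) (T :: 'f \<Rightarrow> nat \<Rightarrow> 'g) T'.
    subspace S \<and> linear T \<and> homeomorphism UNIV S T T'"
proof -
  define T where "T x = (\<lambda>n. t n x)" for x
  have linT: "linear T"
    by (rule linearI)
      (auto simp: T_def fun_eq_iff scaleR_fun_def linear_add[OF lin] linear_scale[OF lin])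
  have "inj T"
    unfolding linear_injective_0[OF linT]
  proof (intro allI impI, rule ccontr)
    fix x assume Tx: "T x = 0" and "x \<noteq> 0"
    then obtain n where n: "\<not> p n x < 1" using sep base by blast
    have "t n x = 0" using Tx by (metis T_def zero_fun_apply)
    then show False using bounds[of n x] n by simp
  qed
  have contT: "continuous_on UNIV T"
  proof (rule continuous_on_coordinatewise_then_product)
    fix n
    show "continuous_on UNIV (\<lambda>x. T x n)"
      unfolding continuous_on_def
    proof
      fix x
      have "(t n \<longlongrightarrow> t n x) (nhds x)"
      proof (rule tendstoI)
        fix e :: real assume e: "0 < e"
        then have "\<forall>\<^sub>F y in nhds (0::'f). p n y < e / 2" by (intro cont) simp
        then have "\<forall>\<^sub>F y in nhds x. p n (y - x) < e / 2"
          using tendsto_minus_point_nhds[of x] unfolding filterlim_iff by blast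
        then show "\<forall>\<^sub>F y in nhds x. dist (t n y) (t n x) < e"
        proof eventually_elim
          case (elim y)
          then show ?case
            using bounds[of n "y - x"] by (simp add: dist_norm linear_diff[OF lin])
        qed
      qed
      then show "((\<lambda>x. T x n) \<longlongrightarrow> T x n) (at x within UNIV)"
        unfolding T_def by (rule filterlim_mono[OF _ order_refl]) (simp add: at_within_def)
    qed
  qed
  define T' where "T' = inv T"
  have T': "T' (T x) = x" for x using \<open>inj T\<close> by (simp add: T'_def)
  have contT': "continuous_on (range T) T'"
    unfolding continuous_on_topological
  proof (intro ballI allI impI)
    fix z B assume z: "z \<in> range T" and B: "open B" "T' z \<in> B"
    obtain x where x: "z = T x" using z by auto
    have "((\<lambda>y. x + y) \<longlongrightarrow> x + 0) (nhds 0)"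
      by (intro tendsto_add tendsto_const filterlim_ident)
    then have "\<forall>\<^sub>F y in nhds 0. x + y \<in> B"
      using B x T' by (intro topological_tendstoD) auto
    then obtain U where U: "open U" "0 \<in> U" "\<And>y. y \<in> U \<Longrightarrow> x + y \<in> B"
      unfolding eventually_nhds by blast
    obtain n where n: "{y. p n y < 1} \<subseteq> U" using base U by blast
    (* Only coordinate n is constrained; the radius 1 / 2 matches the lower bound p n x / 2. *)
    show "\<exists>A. open A \<and> z \<in> A \<and> (\<forall>y\<in>range T. y \<in> A \<longrightarrow> T' y \<in> B)"
    proof (intro exI conjI ballI impI)
      show "open ((\<lambda>w :: nat \<Rightarrow> 'g. w n) -` ball (z n) (1 / 2))"
        by (rule open_vimage[OF open_ball continuous_on_product_coordinates])
      show "z \<in> (\<lambda>w. w n) -` ball (z n) (1 / 2)" by simp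
    next
      fix y assume "y \<in> range T" and near: "y \<in> (\<lambda>w. w n) -` ball (z n) (1 / 2)"
      then obtain x' where x': "y = T x'" by auto
      have "norm (t n (x' - x)) < 1 / 2"
        using near by (simp add: x x' T_def dist_norm norm_minus_commute linear_diff[OF lin])
      then have "p n (x' - x) < 1" using bounds[of n "x' - x"] by simp
      then have "x + (x' - x) \<in> B" using n U(3) by blast
      then show "T' y \<in> B" by (simp add: x' T')
    qed
  qed
  have "homeomorphism UNIV (range T) T T'"
    using contT contT' T' by (auto simp: homeomorphism_def image_image)
  moreover have "subspace (range T)" using linear_subspace_image[OF linT subspace_UNIV] .
  ultimately show ?thesis using linT by blast
qed

lemma metrizable_countable_neighbourhood_base:
  assumes "metrizable_space (euclidean :: 'a::topological_space topology)"
  obtains U :: "nat \<Rightarrow> 'a::topological_space set" where "\<And>n. open (U n)" "\<And>n. a \<in> U n"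
    "\<And>V. open V \<Longrightarrow> a \<in> V \<Longrightarrow> \<exists>n. U n \<subseteq> V"
proof -
  obtain M d where Md: "Metric_space M d" "(euclidean :: 'a topology) = Metric_space.mtopology M d"
    using assms by (auto simp: metrizable_space_def)
  interpret Metric_space M d by fact
  have M: "M = UNIV" using Md(2) by (metis topspace_mtopology topspace_euclidean)
  have op: "open V \<longleftrightarrow> openin mtopology V" for V :: "'a set"
    by (simp flip: Md(2))
  show ?thesis
  proof
    show "open (mball a (inverse (Suc n)))" for n by (simp add: op)
    show "a \<in> mball a (inverse (Suc n))" for n using M by (intro centre_in_mball_iff[THEN iffD2]) auto
  next
    fix V :: "'a set" assume "open V" "a \<in> V"
    then obtain r where r: "0 < r" "mball a r \<subseteq> V" using op openin_mtopology by meson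
    obtain n where "inverse (real (Suc n)) < r" using reals_Archimedean[OF r(1)] by blast
    then have "mball a (inverse (Suc n)) \<subseteq> mball a r" by (intro mball_subset_concentric) simp
    then show "\<exists>n. mball a (inverse (Suc n)) \<subseteq> V" using r(2) by blast
  qed
qed

theorem theorem4p4:
  assumes "gurarij_space TYPE('g::banach)"
    and "frechet_space TYPE('f::real_topological_vector_space)"
    and "separable_space (euclidean :: 'f topology)"
  shows "\<exists>(S :: (nat \<Rightarrow> 'g) set) (T :: 'f \<Rightarrow> nat \<Rightarrow> 'g) T'.
    subspace S \<and> linear T \<and> homeomorphism UNIV S T T'"
proof -
  have metr: "metrizable_space (euclidean :: 'f topology)"
    and lc: "\<And>U :: 'f set. open U \<Longrightarrow> 0 \<in> U \<Longrightarrow> \<exists>V. open V \<and> convex V \<and> 0 \<in> V \<and> V \<subseteq> U"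
    using assms(2) by (auto simp: frechet_space_def)
  obtain U :: "nat \<Rightarrow> 'f set" where U: "\<And>n. open (U n)" "\<And>n. 0 \<in> U n"
    "\<And>V. open V \<Longrightarrow> 0 \<in> V \<Longrightarrow> \<exists>n. U n \<subseteq> V"
    using metrizable_countable_neighbourhood_base[OF metr] by blast
  have "\<exists>p. seminorm p \<and> (\<forall>e>0. \<forall>\<^sub>F x in nhds (0::'f). p x < e) \<and> {x. p x < 1} \<subseteq> U n" for n
    using lc[OF U(1,2)] by (metis convex_neighbourhood_seminorm)
  then obtain p where p: "\<And>n. seminorm (p n)"
    "\<And>n e. 0 < e \<Longrightarrow> \<forall>\<^sub>F x in nhds (0::'f). p n x < e" "\<And>n. {x. p n x < 1} \<subseteq> U n"
    by metis
  obtain D :: "'f set" where D: "countable D" "closure D = UNIV"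
    using assms(3) by (auto simp: separable_space_def)
  have dense: "\<exists>y\<in>D. p n (x - y) < e" if e: "0 < e" for n x e
  proof -
    have "\<forall>\<^sub>F y in nhds x. p n (y - x) < e"
      using tendsto_minus_point_nhds[of x] p(2)[OF e, of n] unfolding filterlim_iff by blast
    then obtain A where A: "open A" "x \<in> A" "\<And>y. y \<in> A \<Longrightarrow> p n (y - x) < e"
      unfolding eventually_nhds by blast
    have "A \<inter> closure D \<noteq> {}" using A D by auto
    then obtain y where "y \<in> D" "y \<in> A" using open_Int_closure_eq_empty[OF A(1)] by auto
    then show ?thesis using A(3) seminorm_commute[OF p(1)] by metis
  qed
  have "\<exists>t :: 'f \<Rightarrow> 'g. linear t \<and> (\<forall>x. p n x / 2 \<le> norm (t x) \<and> norm (t x) \<le> 2 * p n x)" for n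
    by (metis gurarij_embeds_separable_seminorm[OF assms(1) p(1) D(1) dense])
  then obtain t :: "nat \<Rightarrow> 'f \<Rightarrow> 'g" where t: "\<And>n. linear (t n)"
    "\<And>n x. p n x / 2 \<le> norm (t n x) \<and> norm (t n x) \<le> 2 * p n x"
    by metis
  show ?thesis
  proof (rule embedding_of_seminorm_family[OF p(2) _ _ t])
    show "\<exists>n. {x. p n x < 1} \<subseteq> V" if "open V" "0 \<in> V" for V :: "'f set"
      using U(3)[OF that] p(3) by blast
    fix x :: 'f assume "x \<noteq> 0"
    then show "\<exists>V. open V \<and> 0 \<in> V \<and> x \<notin> V"
      using metrizable_imp_t1_space[OF metr] unfolding t1_space_def
      by (metis UNIV_I open_openin topspace_euclidean)
  qed
qed

end
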